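(* For every positive integer $n$ there is a unique polynomial $\mathfrak L_n\in\mathbb Q[x_1,\dots,x_n]$ of degree at most $n$ such that $$\#\bigl(\mathfrak X_n(\mathbf b)\cap\mathbb Z^n\bigr)=\mathfrak L_n(b_1,\dots,b_n)\qquad\text{for all }\mathbf b=(b_1,\dots,b_n)\in\mathbb Z_{>0}^n.$$
   Context: For $\mathbf b=(b_1,\dots,b_n)\in\mathbb Z_{>0}^n$, a $\mathbf b$-parking function is a list $(\beta_1,\dots,\beta_n)$ of positive integers whose nondecreasing rearrangement $\beta_1'\le\cdots\le\beta_n'$ satisfies $\beta_i'\le b_1+\cdots+b_i$ for all $i$. The $\mathbf b$-parking-function polytope $\mathfrak X_n(\mathbf b)\subset\mathbb R^n$ is the convex hull of all $\mathbf b$-parking functions of length $n$. *)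

theory Defs
  imports "HOL-Analysis.Analysis" "HOL-Library.Poly_Mapping"
begin

text \<open>
  An integer \<open>n \<ge> 1\<close> is represented by an arbitrary finite linearly ordered index type \<open>'n\<close>
  with \<open>CARD('n) = n\<close>: up to a unique order isomorphism \<open>'n\<close> is \<open>{1 < \<dots> < n}\<close>, and the
  linear order gives meaning to ``the \<open>i\<close>-th coordinate'', to partial sums and to
  nondecreasing rearrangements. Every \<open>n \<ge> 1\<close> occurs, for instance through the
  linearly ordered numeral types.

  The rearrangement is \<open>\<beta>' = \<beta> \<circ> \<sigma>\<close>. The permutation \<open>\<sigma>\<close> need not be unique, but \<open>\<beta>'\<close> is.
\<close>

definition parking_function :: "('n::{finite,linorder} \<Rightarrow> nat) \<Rightarrow> ('n \<Rightarrow> nat) \<Rightarrow> bool" where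
  "parking_function b \<beta> \<longleftrightarrow>
     (\<forall>i. 0 < \<beta> i) \<and>
     (\<exists>\<sigma>. bij \<sigma> \<and> mono (\<beta> \<circ> \<sigma>) \<and> (\<forall>i. (\<beta> \<circ> \<sigma>) i \<le> (\<Sum>j\<in>{..i}. b j)))"

definition parking_polytope :: "('n::{finite,linorder} \<Rightarrow> nat) \<Rightarrow> (real ^ ('n::{finite,linorder})) set" where
  "parking_polytope b = convex hull {(\<chi> i. real (\<beta> i)) | \<beta>. parking_function b \<beta>}"

definition integer_points :: "(real ^ 'n) set" where
  "integer_points = {x. \<forall>i. x $ i \<in> \<int>}"

text \<open>
  Polynomials with coefficients in \<open>'a\<close> in the variables \<open>x\<^sub>v\<close>, \<open>v :: 'v\<close>, as finitely supported
  functions from exponent vectors to coefficients (so polynomials are formal objects, and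
  equality is equality of coefficients).
\<close>

type_synonym ('v, 'a) mpolynomial = "('v \<Rightarrow>\<^sub>0 nat) \<Rightarrow>\<^sub>0 'a"

definition mpoly_eval :: "('v, 'a::comm_semiring_1) mpolynomial \<Rightarrow> ('v \<Rightarrow> 'a) \<Rightarrow> 'a" where
  "mpoly_eval p x =
     (\<Sum>m\<in>Poly_Mapping.keys p.
        Poly_Mapping.lookup p m * (\<Prod>v\<in>Poly_Mapping.keys m. x v ^ Poly_Mapping.lookup m v))"

text \<open>The total degree; the zero polynomial gets degree \<open>0\<close>.\<close>

definition mpoly_degree :: "('v, 'a::zero) mpolynomial \<Rightarrow> nat" where
  "mpoly_degree p =
     Max (insert 0 ((\<lambda>m. \<Sum>v\<in>Poly_Mapping.keys m. Poly_Mapping.lookup m v) ` Poly_Mapping.keys p))"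

end

theory Submission
  imports Defs "HOL-Combinatorics.Permutations"
begin

text \<open>
  Write \<open>c\<^sub>i = b\<^sub>1 + \<dots> + b\<^sub>i\<close>. A positive integer vector \<open>\<beta>\<close> lies in the polytope exactly when it is
  submajorized by \<open>c\<close>, that is, when \<open>\<Sum>\<^sub>i max 0 (\<beta>\<^sub>i - s) \<le> \<Sum>\<^sub>i max 0 (c\<^sub>i - s)\<close> for every threshold
  \<open>s \<in> \<nat>\<close>. In this form submajorization is a family of sublevel conditions of convex symmetric functions,
  and with truncated subtraction it is a statement about multisets of natural numbers.

  Everything rests on one observation about prescribing a single entry \<open>t\<close> of \<open>\<beta>\<close>. If
  \<open>c\<^sub>j \<le> t \<le> c\<^sub>j\<^sub>+\<^sub>1\<close> are consecutive entries of \<open>c\<close>, then the remaining entries of \<open>\<beta>\<close> are constrained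
  exactly by being submajorized by \<open>c\<close> with the pair \<open>c\<^sub>j, c\<^sub>j\<^sub>+\<^sub>1\<close> merged into the single entry
  \<open>c\<^sub>j + c\<^sub>j\<^sub>+\<^sub>1 - t\<close> (\<open>submajorized_slice_between\<close>); if \<open>t \<le> c\<^sub>1\<close>, they are constrained by being
  submajorized by \<open>c\<^sub>2, \<dots>, c\<^sub>n\<close> (\<open>submajorized_slice_below\<close>). So the slices of the problem are problems
  of the same kind in one dimension less, and this is used twice.

  \<^item> Geometry. Replacing the pair \<open>(c\<^sub>j, c\<^sub>j\<^sub>+\<^sub>1)\<close> by \<open>(c\<^sub>j + c\<^sub>j\<^sub>+\<^sub>1 - t, t)\<close> is a convex combination of
    the two orders of the pair, and lowering an entry to a smaller positive integer does not leave the
    polytope. Induction over the entries (\<open>submajorized_transfer\<close>) therefore carries membership in the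
    polytope from the rearrangements of \<open>c\<close> to every positive \<open>\<beta>\<close> that \<open>c\<close> submajorizes. Conversely, all
    parking functions satisfy the submajorization inequalities, so their convex hull does.

  \<^item> Counting. Let \<open>N\<^sub>n(c)\<close> be the number of positive integer vectors submajorized by the weakly increasing
    sequence \<open>c\<close> of length \<open>n\<close>. Summing over the first entry \<open>t\<close> and substituting
    \<open>u = c\<^sub>j + c\<^sub>j\<^sub>+\<^sub>1 - t\<close>,
    \<open>N\<^sub>n\<^sub>+\<^sub>1(c) = c\<^sub>1 N\<^sub>n(c\<^sub>2, \<dots>) + \<Sum>\<^sub>j \<Sum>\<^sub>u N\<^sub>n(\<dots>, c\<^sub>j\<^sub>-\<^sub>1, u, c\<^sub>j\<^sub>+\<^sub>2, \<dots>)\<close>, where \<open>c\<^sub>j \<le> u < c\<^sub>j\<^sub>+\<^sub>1\<close>.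
    Summing a polynomial over an interval raises the degree by one and is polynomial in the end points,
    so \<open>N\<^sub>n\<close> is a polynomial of degree at most \<open>n\<close> in \<open>c\<close>, hence in \<open>b\<close>
    (\<open>card_dominated_lists_polynomial\<close>).

  Uniqueness is the fact that a polynomial is determined by its values at the vectors of positive
  integers (\<open>mpoly_eval_positive_eq_imp_eq\<close>).
\<close>

section \<open>Submajorization of multisets\<close>

definition excess :: "nat multiset \<Rightarrow> nat \<Rightarrow> nat" where
  "excess M s = (\<Sum>x\<in>#M. x - s)"

definition submajorized :: "nat multiset \<Rightarrow> nat multiset \<Rightarrow> bool" where
  "submajorized Y D \<longleftrightarrow> (\<forall>s. excess Y s \<le> excess D s)"

lemma excess_simps [simp]:
  "excess {#} s = 0" "excess (add_mset x M) s = x - s + excess M s"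
  by (simp_all add: excess_def)

text \<open>
  As a function of the threshold, the excess is convex and piecewise linear: on each unit interval its
  slope is minus the number of entries at or beyond its right end.
  The two slices below are proved by comparing slopes.
\<close>

lemma excess_Suc: "excess M s = excess M (Suc s) + size {#x \<in># M. s < x#}"
  by (induction M) auto

lemma excess_le_slope:
  assumes "s \<le> e" "\<And>r. s \<le> r \<Longrightarrow> r < e \<Longrightarrow> size {#x \<in># M. r < x#} \<le> K"
  shows "excess M s \<le> excess M e + K * (e - s)"
  using assms
proof (induction e rule: dec_induct)
  case (step n)
  have "excess M s \<le> excess M n + K * (n - s)"
    using step by auto
  also have "excess M n \<le> excess M (Suc n) + K"
    using excess_Suc[of M n] step.prems[of n] step.hyps by auto
  finally show ?case using step.hyps by (simp add: Suc_diff_le)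
qed simp

lemma excess_ge_slope:
  assumes "s \<le> e" "\<And>r. s \<le> r \<Longrightarrow> r < e \<Longrightarrow> K \<le> size {#x \<in># M. r < x#}"
  shows "excess M e + K * (e - s) \<le> excess M s"
  using assms
proof (induction e rule: dec_induct)
  case (step n)
  have "excess M n + K * (n - s) \<le> excess M s"
    using step by auto
  moreover have "excess M (Suc n) + K \<le> excess M n"
    using excess_Suc[of M n] step.prems[of n] step.hyps by auto
  ultimately show ?case using step.hyps by (simp add: Suc_diff_le)
qed simp

lemma size_above_antimono:
  assumes "r \<le> s"
  shows "size {#x \<in># M. s < x#} \<le> size {#x \<in># M. r < (x::nat)#}"
  using assms by (induction M) auto

lemma excess_linear_on_gap:
  assumes "\<forall>x\<in>#M. x \<le> b \<or> a \<le> x" "b \<le> s" "s \<le> r" "r \<le> a"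
  shows "excess M s = excess M r + size {#x \<in># M. a \<le> x#} * (r - s)"
  using assms by (induction M) auto

text \<open>
  No entry of \<open>M\<close> lies strictly between \<open>b\<close> and \<open>a\<close>. At thresholds outside \<open>(b, a)\<close> the two
  conditions are literally the same, because there the excess of \<open>{a, b}\<close> equals that of \<open>{t, a + b - t}\<close>.
  Inside \<open>(b, a)\<close> the right-hand condition is stronger, and it is recovered
  from the two end points: the excess of \<open>M\<close> has constant slope \<open>-K\<close> there, while the excess of \<open>Y\<close>
  is convex with integer slopes. Where the slope of \<open>Y\<close> is at least \<open>-K\<close>, compare with the end point \<open>a\<close>;
  where it is at most \<open>-(K + 1)\<close>, compare with the end point \<open>b\<close>. Integrality of the slopes excludes
  anything in between.
\<close>

lemma submajorized_slice_between:
  assumes bt: "b \<le> t" and ta: "t \<le> a" and M: "\<forall>x\<in>#M. x \<le> b \<or> a \<le> x"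
  shows "submajorized (add_mset t Y) (add_mset a (add_mset b M)) \<longleftrightarrow>
         submajorized Y (add_mset (a + b - t) M)" (is "?L \<longleftrightarrow> ?R")
proof
  assume ?R
  have "t - s + (a + b - t - s) \<le> (a - s) + (b - s)" for s
    using bt ta by auto
  moreover have "excess Y s \<le> a + b - t - s + excess M s" for s
    using \<open>?R\<close> by (simp add: submajorized_def)
  ultimately show ?L
    unfolding submajorized_def excess_simps
    by (smt (verit) add.assoc add.commute add_left_mono le_trans)
next
  assume ?L
  then have L: "t - s + excess Y s \<le> (a - s) + (b - s) + excess M s" for s
    by (simp add: submajorized_def add.assoc)
  define K where "K = size {#x \<in># M. a \<le> x#}"
  have "excess Y s \<le> (a + b - t - s) + excess M s" for s
  proof (cases "s \<le> b \<or> a \<le> s")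
    case True
    then show ?thesis using L[of s] bt ta by auto
  next
    case False
    then have s: "b \<le> s" "s \<le> a" by auto
    show ?thesis
    proof (cases "size {#x \<in># Y. s < x#} \<le> K")
      case True
      have "excess Y s \<le> excess Y a + K * (a - s)"
        using True size_above_antimono[of s _ Y] s by (intro excess_le_slope) (auto intro: order_trans)
      moreover have "excess M s = excess M a + K * (a - s)"
        unfolding K_def using M s by (intro excess_linear_on_gap) auto
      moreover have "excess Y a \<le> excess M a"
        using L[of a] bt ta by auto
      ultimately show ?thesis by linarith
    next
      case False
      have "excess Y s + Suc K * (s - b) \<le> excess Y b"
        using False size_above_antimono[of _ s Y] s
        by (intro excess_ge_slope) (auto simp: not_le Suc_le_eq intro: less_le_trans)
      moreover have "excess M b = excess M s + K * (s - b)"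
        unfolding K_def using M s by (intro excess_linear_on_gap) auto
      moreover have "excess Y b \<le> a - t + excess M b"
        using L[of b] bt ta by auto
      ultimately have "excess Y s + (s - b) \<le> a - t + excess M s"
        by simp
      then show ?thesis using s bt ta by linarith
    qed
  qed
  then show ?R by (simp add: submajorized_def)
qed

text \<open>
  Below \<open>a\<close> the excess of \<open>M\<close> has slope \<open>- size M\<close>, the steepest possible for a multiset of that size, so
  the conditions at thresholds below \<open>a\<close> follow from the one at \<open>a\<close>.
\<close>

lemma submajorized_slice_below:
  assumes ta: "t \<le> a" and M: "\<forall>x\<in>#M. a \<le> x" and sz: "size Y = size M"
  shows "submajorized (add_mset t Y) (add_mset a M) \<longleftrightarrow> submajorized Y M" (is "?L \<longleftrightarrow> ?R")
proof
  assume ?R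
  then show ?L using ta unfolding submajorized_def excess_simps
    by (meson add_mono diff_le_mono)
next
  assume ?L
  then have L: "t - s + excess Y s \<le> a - s + excess M s" for s
    by (simp add: submajorized_def)
  have "excess Y s \<le> excess M s" for s
  proof (cases "a \<le> s")
    case True
    then show ?thesis using L[of s] ta by auto
  next
    case False
    have "excess Y s \<le> excess Y a + size M * (a - s)"
      using False by (intro excess_le_slope) (auto simp flip: sz intro: size_filter_mset_lesseq)
    moreover have "excess M a + size M * (a - s) \<le> excess M s"
    proof (rule excess_ge_slope)
      fix r assume "r < a"
      then have "{#x \<in># M. r < x#} = M"
        using M by (auto simp: filter_mset_eq_conv)
      then show "size M \<le> size {#x \<in># M. r < x#}" by simp
    qed (use False in auto)
    ultimately show ?thesis using L[of a] ta by auto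
  qed
  then show ?R by (simp add: submajorized_def)
qed

lemma submajorized_imp_le_bound:
  assumes "submajorized (add_mset t Y) D" "\<forall>x\<in>#D. x \<le> m"
  shows "t \<le> m"
proof -
  have "excess D m = 0" using assms(2) by (auto simp: excess_def)
  then show ?thesis using assms(1) unfolding submajorized_def
    by (metis add_is_0 diff_is_0_eq excess_simps(2) le_zero_eq)
qed

text \<open>
  Submajorization can be realized by averaging pairs and by lowering entries. The multiset \<open>Z\<close> collects the
  entries of \<open>Y\<close> that have already been produced, so that \<open>P\<close> always speaks about multisets of the same size.
\<close>

lemma submajorized_transfer:
  assumes transfer: "\<And>a b t M. b \<le> t \<Longrightarrow> t \<le> a \<Longrightarrow> P (add_mset a (add_mset b M)) \<Longrightarrow>
                       P (add_mset (a + b - t) (add_mset t M))"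
    and lower: "\<And>b t M. 0 < t \<Longrightarrow> t \<le> b \<Longrightarrow> P (add_mset b M) \<Longrightarrow> P (add_mset t M)"
    and "submajorized Y D" "size Y = size D" "\<forall>y\<in>#Y. 0 < y" "P (D + Z)"
  shows "P (Y + Z)"
  using assms(3-)
proof (induction Y arbitrary: D Z)
  case empty
  then show ?case by simp
next
  case (add t Y)
  \<comment> \<open>The entry t is produced from its two neighbours in D: a is the least entry of D that is
    at least t, and b is the greatest entry below t, if there is one.\<close>
  define B where "B = {x. x \<in># D \<and> x < t}"
  define A where "A = {x. x \<in># D \<and> t \<le> x}"
  have fin: "finite A" "finite B" by (simp_all add: A_def B_def)
  have "D \<noteq> {#}" using add.prems by auto
  then have "t \<le> Max (set_mset D)"
    using add.prems by (intro submajorized_imp_le_bound[of t Y D]) auto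
  then have "A \<noteq> {}"
    unfolding A_def using \<open>D \<noteq> {#}\<close> by (auto intro!: exI[of _ "Max (set_mset D)"])
  define a where "a = Min A"
  have "a \<in> A" "\<forall>x\<in>A. a \<le> x" unfolding a_def using fin \<open>A \<noteq> {}\<close> by auto
  then have a: "a \<in># D" "t \<le> a" "\<forall>x\<in>#D. t \<le> x \<longrightarrow> a \<le> x" by (auto simp: A_def)
  show ?case
  proof (cases "B = {}")
    case True
    define M where "M = D - {#a#}"
    have D: "D = add_mset a M" using a by (simp add: M_def)
    have "\<forall>x\<in>#M. a \<le> x" using True a D by (auto simp: B_def not_less)
    then have sub: "submajorized Y M"
      using add.prems a submajorized_slice_below[of t a M Y] by (simp add: D)
    have "P (add_mset t (M + Z))"
      using lower[of t a "M + Z"] add.prems a by (simp add: D)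
    then have "P (Y + add_mset t Z)"
      using add.prems sub by (intro add.IH[of M]) (auto simp: D)
    then show ?thesis by simp
  next
    case False
    define b where "b = Max B"
    have "b \<in> B" "\<forall>x\<in>B. x \<le> b" unfolding b_def using fin False by auto
    then have b: "b \<in># D" "b < t" "\<forall>x\<in>#D. x < t \<longrightarrow> x \<le> b" by (auto simp: B_def)
    define M where "M = D - {#a#} - {#b#}"
    have "b \<in># D - {#a#}" using a b by (auto simp: in_diff_count)
    then have D: "D = add_mset a (add_mset b M)" using a unfolding M_def by (metis insert_DiffM)
    have "\<forall>x\<in>#M. x \<le> b \<or> a \<le> x" using a b D
      by (metis insert_iff linorder_not_le set_mset_add_mset_insert)
    then have sub: "submajorized Y (add_mset (a + b - t) M)"
      using add.prems a b submajorized_slice_between[of b t a M Y] by (simp add: D)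
    have "P (add_mset t (add_mset (a + b - t) (M + Z)))"
      using transfer[of b t a "M + Z"] add.prems a b
      by (simp add: D add_mset_commute[of t])
    then have "P (Y + add_mset t Z)"
      using add.prems sub by (intro add.IH[of "add_mset (a + b - t) M"]) (auto simp: D)
    then show ?thesis by simp
  qed
qed

section \<open>Polynomial functions and summation\<close>

text \<open>
  \<open>poly_fun k f\<close>: \<open>f\<close> is a polynomial function of total degree at most \<open>k\<close>. The set of variables may be
  infinite, so one type serves for all sequences \<open>c\<close>, whatever their length. The generation by multiplication with
  single variables is what makes the constructions below inductive.
\<close>

inductive poly_fun :: "nat \<Rightarrow> (('v \<Rightarrow> rat) \<Rightarrow> rat) \<Rightarrow> bool" where
  poly_fun_const: "poly_fun k (\<lambda>x. c)"
| poly_fun_add: "poly_fun k f \<Longrightarrow> poly_fun k g \<Longrightarrow> poly_fun k (\<lambda>x. f x + g x)"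
| poly_fun_var_mult: "poly_fun k f \<Longrightarrow> poly_fun (Suc k) (\<lambda>x. x v * f x)"

lemma poly_fun_mono: "poly_fun k f \<Longrightarrow> k \<le> l \<Longrightarrow> poly_fun l f"
proof (induction arbitrary: l rule: poly_fun.induct)
  case (poly_fun_var_mult k f v)
  then obtain l' where "l = Suc l'" "k \<le> l'" by (cases l) auto
  then show ?case using poly_fun_var_mult.IH by (auto intro: poly_fun.intros)
qed (auto intro: poly_fun.intros)

lemma poly_fun_var: "poly_fun (Suc 0) (\<lambda>x. x v)"
  using poly_fun_var_mult[OF poly_fun_const[of 0 1]] by simp

lemma poly_fun_mult:
  assumes "poly_fun k f" "poly_fun l g"
  shows "poly_fun (k + l) (\<lambda>x. f x * g x)"
  using assms(1)
proof induction
  case (poly_fun_const k c)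
  have "poly_fun l (\<lambda>x. c * g x)"
    using assms(2)
  proof induction
    case (poly_fun_var_mult l g v)
    from poly_fun.poly_fun_var_mult[OF poly_fun_var_mult.IH, of v] show ?case
      by (simp add: mult.left_commute)
  qed (auto simp: distrib_left intro: poly_fun.intros)
  then show ?case by (rule poly_fun_mono) simp
next
  case (poly_fun_add k f1 f2)
  then show ?case by (auto simp: distrib_right intro: poly_fun.intros)
next
  case (poly_fun_var_mult k f v)
  from poly_fun.poly_fun_var_mult[OF poly_fun_var_mult.IH, of v] show ?case
    by (simp add: mult.assoc)
qed

lemma poly_fun_cmult: "poly_fun k f \<Longrightarrow> poly_fun k (\<lambda>x. c * f x)"
  using poly_fun_mult[OF poly_fun_const[of 0 c]] by simp

lemma poly_fun_diff: "poly_fun k f \<Longrightarrow> poly_fun k g \<Longrightarrow> poly_fun k (\<lambda>x. f x - g x)"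
  using poly_fun_add[OF _ poly_fun_cmult[of k g "-1"]] by simp

lemma poly_fun_sum:
  "(\<And>i. i \<in> I \<Longrightarrow> poly_fun k (f i)) \<Longrightarrow> poly_fun k (\<lambda>x. \<Sum>i\<in>I. f i x)"
  by (induction I rule: infinite_finite_induct) (auto intro: poly_fun.intros)

lemma poly_fun_compose:
  assumes "poly_fun k f" "\<And>v. poly_fun (Suc 0) (\<lambda>x. g x v)"
  shows "poly_fun k (\<lambda>x. f (g x))"
  using assms(1)
proof induction
  case (poly_fun_var_mult k f v)
  from poly_fun_mult[OF assms(2)[of v] poly_fun_var_mult.IH] show ?case by simp
qed (auto intro: poly_fun.intros)

lemma poly_fun_gbinomial: "poly_fun k (\<lambda>x. x v gchoose k)"
proof (induction k)
  case (Suc k)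
  have "poly_fun (Suc 0) (\<lambda>x. inverse (of_nat (Suc k)) * (x v - of_nat k))"
    by (intro poly_fun_cmult poly_fun_diff poly_fun_var poly_fun_const)
  from poly_fun_mult[OF this Suc]
  show ?case
    by (simp add: gbinomial_prod_rev field_simps)
qed (simp add: poly_fun_const)

text \<open>
  A single antidifference is not enough for an induction over \<open>f\<close>: by summation by parts, an
  antidifference of \<open>x\<^sub>v f\<close> involves a second antidifference of \<open>f\<close>. The statement therefore asks for a whole
  sequence \<open>F\<^sub>0 = f, F\<^sub>1, F\<^sub>2, \<dots>\<close> with \<open>\<Delta> F\<^sub>r\<^sub>+\<^sub>1 = F\<^sub>r\<close>, where \<open>\<Delta>\<close> is the difference operator in the
  variable \<open>v\<close>.
\<close>

lemma poly_fun_iterated_antidifference: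
  assumes "poly_fun k f"
  shows "\<exists>F. F 0 = f \<and>
             (\<forall>r. poly_fun (k + r) (F r) \<and>
                  (\<forall>x. F (Suc r) (x(v := x v + 1)) = F (Suc r) x + F r x))"
  using assms
proof induction
  case (poly_fun_const k c)
  define F where "F r x = c * (x v gchoose r)" for r and x :: "'a \<Rightarrow> rat"
  have "poly_fun (k + r) (F r)" for r
    unfolding F_def by (rule poly_fun_cmult, rule poly_fun_mono, rule poly_fun_gbinomial) simp
  moreover have "F (Suc r) (x(v := x v + 1)) = F (Suc r) x + F r x" for r x
    by (simp add: F_def gbinomial_Suc_Suc distrib_left)
  moreover have "F 0 = (\<lambda>x. c)" by (auto simp: F_def)
  ultimately show ?case by blast
next
  case (poly_fun_add k f g)
  then obtain F G where
    "F 0 = f" "\<forall>r. poly_fun (k + r) (F r) \<and> (\<forall>x. F (Suc r) (x(v := x v + 1)) = F (Suc r) x + F r x)"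
    "G 0 = g" "\<forall>r. poly_fun (k + r) (G r) \<and> (\<forall>x. G (Suc r) (x(v := x v + 1)) = G (Suc r) x + G r x)"
    by blast
  then show ?case
    by (intro exI[of _ "\<lambda>r x. F r x + G r x"]) (auto simp: fun_upd_def intro: poly_fun.poly_fun_add)
next
  case (poly_fun_var_mult k f w)
  then obtain F where F: "F 0 = f" "\<And>r. poly_fun (k + r) (F r)"
    "\<And>r x. F (Suc r) (x(v := x v + 1)) = F (Suc r) x + F r x"
    by blast
  show ?case
  proof (cases "w = v")
    case False
    have "poly_fun (Suc k + r) (\<lambda>x. x w * F r x)" for r
      using poly_fun.poly_fun_var_mult[OF F(2)[of r], of w] by simp
    then show ?thesis using F False
      by (intro exI[of _ "\<lambda>r x. x w * F r x"]) (auto simp: distrib_left fun_upd_def)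
  next
    case True
    \<comment> \<open>The discrete Leibniz rule gives \<Delta>(x F(r+1)) = x F(r) + F(r) + F(r+1). The correction
      term of G(r+1) has the difference (r+1) (F(r) + F(r+1)); subtracting it leaves G(r).\<close>
    define G where "G r x = x v * F r x - of_nat r * (F r x + F (Suc r) x)" for r x
    have "poly_fun (Suc k + r) (G r)" for r
      unfolding G_def
    proof (intro poly_fun_diff poly_fun_cmult poly_fun.poly_fun_add)
      show "poly_fun (Suc k + r) (\<lambda>x. x v * F r x)"
        using poly_fun.poly_fun_var_mult[OF F(2)[of r], of v] by simp
      show "poly_fun (Suc k + r) (F r)" by (rule poly_fun_mono[OF F(2)]) simp
      show "poly_fun (Suc k + r) (F (Suc r))" by (rule poly_fun_mono[OF F(2)]) simp
    qed
    moreover have "G (Suc r) (x(v := x v + 1)) = G (Suc r) x + G r x" for r x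
      by (simp only: G_def F(3) fun_upd_same of_nat_Suc) (simp add: algebra_simps)
    moreover have "G 0 = (\<lambda>x. x w * f x)" by (auto simp: G_def F(1) True)
    ultimately show ?thesis by blast
  qed
qed

lemma poly_fun_interval_sum:
  assumes "poly_fun k f"
  obtains F where "poly_fun (Suc k) F"
    and "\<And>x p q. p \<le> q \<Longrightarrow> (\<Sum>u\<in>{p..<q}. f (x(v := of_nat u))) =
                        F (x(v := of_nat q)) - F (x(v := of_nat p))"
proof -
  obtain F where F: "F 0 = f" "\<And>r. poly_fun (k + r) (F r)"
    "\<And>r x. F (Suc r) (x(v := x v + 1)) = F (Suc r) x + F r x"
    using poly_fun_iterated_antidifference[OF assms] by blast
  have "(\<Sum>u\<in>{p..<q}. f (x(v := of_nat u))) = F 1 (x(v := of_nat q)) - F 1 (x(v := of_nat p))"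
    if "p \<le> q" for x p q
    using that
  proof (induction q rule: dec_induct)
    case (step q)
    have "F 1 (x(v := of_nat (Suc q))) = F 1 (x(v := of_nat q)) + f (x(v := of_nat q))"
      using F(3)[of 0 "x(v := of_nat q)"] by (simp add: F(1) add.commute)
    then show ?case using step.IH step.hyps by (simp add: sum.atLeastLessThan_Suc fun_upd_def)
  qed simp
  then show ?thesis using that[of "F 1"] F(2)[of 1] by simp
qed

section \<open>Counting submajorized lists\<close>

definition dominated_lists :: "nat \<Rightarrow> (nat \<Rightarrow> nat) \<Rightarrow> nat list set" where
  "dominated_lists n c =
     {ys. length ys = n \<and> (\<forall>y\<in>set ys. 0 < y) \<and> submajorized (mset ys) (mset (map c [0..<n]))}"

lemma member_le_excess_0: "y \<in># M \<Longrightarrow> y \<le> excess M 0"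
  by (auto dest!: multi_member_split)

lemma finite_dominated_lists: "finite (dominated_lists n c)"
proof (rule finite_subset)
  let ?T = "excess (mset (map c [0..<n])) 0"
  show "dominated_lists n c \<subseteq> {ys. set ys \<subseteq> {..?T} \<and> length ys = n}"
  proof (safe; clarsimp simp: dominated_lists_def)
    fix ys y assume "submajorized (mset ys) (image_mset c (mset_set {0..<length ys}))" "y \<in> set ys"
    then show "y \<le> excess (image_mset c (mset_set {0..<length ys})) 0"
      using member_le_excess_0[of y "mset ys"] by (auto simp: submajorized_def intro: order_trans)
  qed
qed (rule finite_lists_length_eq, simp)

text \<open>
  The sequence \<open>c\<^sub>0, \<dots>, c\<^sub>j\<^sub>-\<^sub>1, u, c\<^sub>j\<^sub>+\<^sub>2, \<dots>\<close>: the step from \<open>c\<^sub>j\<close> to \<open>c\<^sub>j\<^sub>+\<^sub>1\<close> is merged into one entry. The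
  type of the values is arbitrary because the construction is applied both to sequences
  of natural numbers and to the rational arguments of polynomial functions.
\<close>

definition merge_step :: "(nat \<Rightarrow> 'a) \<Rightarrow> nat \<Rightarrow> 'a \<Rightarrow> nat \<Rightarrow> 'a" where
  "merge_step c j u i = (if i < j then c i else if i = j then u else c (Suc i))"

lemma mset_map_split_pair:
  assumes "j < n"
  shows "mset (map c [0..<Suc n]) =
           add_mset (c (Suc j)) (add_mset (c j) (mset (map c [0..<j]) + mset (map c [Suc (Suc j)..<Suc n])))"
proof -
  have "[0..<Suc n] = [0..<j] @ j # Suc j # [Suc (Suc j)..<Suc n]"
    using assms upt_add_eq_append[of 0 j "Suc n - j"] by (simp add: upt_conv_Cons del: upt_Suc)
  then show ?thesis by simp
qed

lemma mset_map_merge_step: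
  assumes "j < n"
  shows "mset (map (merge_step c j u) [0..<n]) =
           add_mset u (mset (map c [0..<j]) + mset (map c [Suc (Suc j)..<Suc n]))"
proof -
  have "[0..<n] = [0..<j] @ j # [Suc j..<n]"
    using assms upt_add_eq_append[of 0 j "n - j"] by (simp add: upt_conv_Cons)
  moreover have "map (merge_step c j u) [0..<j] = map c [0..<j]"
    by (simp add: merge_step_def)
  moreover have "map (merge_step c j u) [Suc j..<n] = map c (map Suc [Suc j..<n])"
    unfolding map_map by (rule map_cong) (auto simp: merge_step_def)
  moreover have "merge_step c j u j = u"
    by (simp add: merge_step_def)
  ultimately have "map (merge_step c j u) [0..<n] = map c [0..<j] @ u # map c [Suc (Suc j)..<Suc n]"
    by (simp only: map_append list.map map_Suc_upt)
  then show ?thesis by (simp del: upt_Suc)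
qed

text \<open>
  Merging stays within the weakly increasing sequences, so one polynomial per dimension suffices.
\<close>

lemma mono_merge_step:
  assumes "mono c" "c j \<le> u" "u \<le> c (Suc j)"
  shows "mono (merge_step c j u)"
proof (rule mono_iff_le_Suc[THEN iffD2], rule allI)
  fix i
  consider "Suc i < j" | "Suc i = j" | "i = j" | "j < i" by linarith
  then show "merge_step c j u i \<le> merge_step c j u (Suc i)"
  proof cases
    case 2
    then show ?thesis using assms(2) monoD[OF assms(1), of i j] by (auto simp: merge_step_def)
  next
    case 3
    then show ?thesis using assms(3) monoD[OF assms(1), of "Suc j" "Suc (Suc j)"]
      by (auto simp: merge_step_def)
  qed (auto simp: merge_step_def intro!: monoD[OF assms(1)])
qed

lemma dominated_lists_Cons_below:
  assumes "mono c" "0 < t" "t \<le> c 0"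
  shows "t # ys \<in> dominated_lists (Suc n) c \<longleftrightarrow> ys \<in> dominated_lists n (c \<circ> Suc)"
proof (cases "length ys = n")
  case True
  have D: "mset (map c [0..<Suc n]) = add_mset (c 0) (mset (map (c \<circ> Suc) [0..<n]))"
    by (simp only: upt_conv_Cons[OF zero_less_Suc] flip: map_Suc_upt) simp
  have "submajorized (mset (t # ys)) (mset (map c [0..<Suc n])) \<longleftrightarrow>
        submajorized (mset ys) (mset (map (c \<circ> Suc) [0..<n]))"
    unfolding D mset.simps using assms True
    by (intro submajorized_slice_below) (auto intro: monoD)
  then show ?thesis using True assms by (simp add: dominated_lists_def del: mset.simps map_map upt_Suc)
qed (simp add: dominated_lists_def)

lemma dominated_lists_Cons_between:
  assumes "mono c" "j < n" "c j < t" "t \<le> c (Suc j)"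
  shows "t # ys \<in> dominated_lists (Suc n) c \<longleftrightarrow>
         ys \<in> dominated_lists n (merge_step c j (c (Suc j) + c j - t))"
proof -
  have "submajorized (mset (t # ys)) (mset (map c [0..<Suc n])) \<longleftrightarrow>
        submajorized (mset ys) (mset (map (merge_step c j (c (Suc j) + c j - t)) [0..<n]))"
    unfolding mset_map_split_pair[OF assms(2)] mset_map_merge_step[OF assms(2)] mset.simps
    using assms by (intro submajorized_slice_between) (auto intro: monoD)
  then show ?thesis using assms by (simp add: dominated_lists_def del: mset.simps upt_Suc)
qed

lemma dominated_lists_hd_le:
  assumes "mono c" "t # ys \<in> dominated_lists (Suc n) c"
  shows "t \<le> c n"
proof (rule submajorized_imp_le_bound)
  show "submajorized (add_mset t (mset ys)) (mset (map c [0..<Suc n]))"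
    using assms(2) by (simp add: dominated_lists_def del: upt_Suc)
  show "\<forall>x\<in>#mset (map c [0..<Suc n]). x \<le> c n"
    using assms(1) by (auto intro: monoD simp del: upt_Suc simp: less_Suc_eq_le)
qed

lemma sum_over_steps:
  fixes g :: "nat \<Rightarrow> 'a::comm_monoid_add"
  assumes "mono c"
  shows "(\<Sum>t\<in>{1..c n}. g t) = (\<Sum>t\<in>{1..c 0}. g t) + (\<Sum>j<n. \<Sum>t\<in>{c j<..c (Suc j)}. g t)"
proof (induction n)
  case (Suc n)
  have "{1..c (Suc n)} = {1..c n} \<union> {c n<..c (Suc n)}"
    using monoD[OF assms, of n "Suc n"] by auto
  then have "(\<Sum>t\<in>{1..c (Suc n)}. g t) = (\<Sum>t\<in>{1..c n}. g t) + (\<Sum>t\<in>{c n<..c (Suc n)}. g t)"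
    by (simp, intro sum.union_disjoint) auto
  then show ?case using Suc by (simp add: add.assoc)
qed simp

text \<open>
  The first entry \<open>t\<close> ranges over \<open>{1..c n}\<close>, which the values of \<open>c\<close> cut into intervals; on each of
  them the slice lemmas describe the admissible tails. The reflection \<open>t \<mapsto> c j + c (Suc j) - t\<close> turns
  the half-open interval \<open>{c j<..c (Suc j)}\<close> into \<open>{c j..<c (Suc j)}\<close>.
\<close>

lemma card_dominated_lists_Suc:
  assumes "mono c"
  shows "card (dominated_lists (Suc n) c) =
           c 0 * card (dominated_lists n (c \<circ> Suc)) +
           (\<Sum>j<n. \<Sum>u\<in>{c j..<c (Suc j)}. card (dominated_lists n (merge_step c j u)))"
proof -
  define S where "S t = {ys. t # ys \<in> dominated_lists (Suc n) c}" for t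
  have split: "dominated_lists (Suc n) c = (\<Union>t\<in>{1..c n}. (#) t ` S t)"
  proof (intro equalityI subsetI)
    fix ys assume ys: "ys \<in> dominated_lists (Suc n) c"
    then obtain t ys' where t: "ys = t # ys'" "0 < t"
      by (cases ys) (auto simp: dominated_lists_def)
    then show "ys \<in> (\<Union>t\<in>{1..c n}. (#) t ` S t)"
      using ys dominated_lists_hd_le[OF assms] by (auto simp: S_def)
  qed (auto simp: S_def)
  have fin: "finite (S t)" for t
  proof (rule finite_imageD)
    show "finite ((#) t ` S t)"
      by (rule finite_subset[OF _ finite_dominated_lists[of "Suc n" c]]) (auto simp: S_def)
  qed auto
  have "card (dominated_lists (Suc n) c) = (\<Sum>t\<in>{1..c n}. card ((#) t ` S t))"
    unfolding split using fin by (intro card_UN_disjoint) auto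
  also have "\<dots> = (\<Sum>t\<in>{1..c n}. card (S t))"
    by (intro sum.cong refl card_image) auto
  also have "\<dots> = (\<Sum>t\<in>{1..c 0}. card (S t)) + (\<Sum>j<n. \<Sum>t\<in>{c j<..c (Suc j)}. card (S t))"
    by (rule sum_over_steps[OF assms])
  also have "(\<Sum>t\<in>{1..c 0}. card (S t)) = c 0 * card (dominated_lists n (c \<circ> Suc))"
    using dominated_lists_Cons_below[OF assms] by (simp add: S_def)
  also have "(\<Sum>j<n. \<Sum>t\<in>{c j<..c (Suc j)}. card (S t)) =
             (\<Sum>j<n. \<Sum>u\<in>{c j..<c (Suc j)}. card (dominated_lists n (merge_step c j u)))"
  proof (rule sum.cong[OF refl])
    fix j assume j: "j \<in> {..<n}"
    have "c j \<le> c (Suc j)" using assms by (simp add: monoD)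
    then show "(\<Sum>t\<in>{c j<..c (Suc j)}. card (S t)) =
          (\<Sum>u\<in>{c j..<c (Suc j)}. card (dominated_lists n (merge_step c j u)))"
      using j dominated_lists_Cons_between[OF assms, of j n]
      by (intro sum.reindex_bij_witness[of _ "\<lambda>u. c (Suc j) + c j - u" "\<lambda>t. c (Suc j) + c j - t"])
         (auto simp: S_def)
  qed
  finally show ?thesis .
qed

lemma card_dominated_lists_polynomial:
  "\<exists>f. poly_fun n f \<and> (\<forall>c. mono c \<longrightarrow> of_nat (card (dominated_lists n c)) = f (\<lambda>i. of_nat (c i)))"
proof (induction n)
  case 0
  have "dominated_lists 0 c = {[]}" for c
    by (auto simp: dominated_lists_def submajorized_def)
  then show ?case by (intro exI[of _ "\<lambda>x. 1"]) (auto intro: poly_fun_const)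
next
  case (Suc n)
  then obtain f :: "(nat \<Rightarrow> rat) \<Rightarrow> rat" where f: "poly_fun n f"
    "\<And>c. mono c \<Longrightarrow> of_nat (card (dominated_lists n c)) = f (\<lambda>i. of_nat (c i))"
    by blast
  have "\<exists>F. poly_fun (Suc n) F \<and> (\<forall>x p q. p \<le> q \<longrightarrow>
           (\<Sum>u\<in>{p..<q}. f (x(j := of_nat u))) = F (x(j := of_nat q)) - F (x(j := of_nat p)))" for j
    using poly_fun_interval_sum[OF f(1), of j] by metis
  then obtain F where F: "\<And>j. poly_fun (Suc n) (F j)"
    "\<And>j x p q. p \<le> q \<Longrightarrow>
       (\<Sum>u\<in>{p..<q}. f (x(j := of_nat u))) = F j (x(j := of_nat q)) - F j (x(j := of_nat p))"
    by metis
  \<comment> \<open>The recursion for the cardinalities, with each inner sum replaced by the values of an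
    antidifference at the two ends of its interval.\<close>
  define g :: "(nat \<Rightarrow> rat) \<Rightarrow> rat" where
    "g x = x 0 * f (\<lambda>i. x (Suc i)) +
           (\<Sum>j<n. F j (merge_step x j (x (Suc j))) - F j (merge_step x j (x j)))" for x
  have "poly_fun (Suc 0) (\<lambda>x. merge_step x j (x k) i)" for j k i
    by (cases "i < j"; cases "i = j") (simp_all add: merge_step_def poly_fun_var)
  then have "poly_fun (Suc n) g"
    unfolding g_def
    by (intro poly_fun_add poly_fun_var_mult poly_fun_sum poly_fun_diff
          poly_fun_compose[OF f(1)] poly_fun_compose[OF F(1)])
       (auto intro: poly_fun_var)
  moreover have "of_nat (card (dominated_lists (Suc n) c)) = g (\<lambda>i. of_nat (c i))"
    if c: "mono c" for c
  proof -
    let ?x = "\<lambda>i. of_nat (c i) :: rat"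
    have "mono (c \<circ> Suc)" using c by (auto simp: mono_def)
    then have "of_nat (card (dominated_lists n (c \<circ> Suc))) = f (\<lambda>i. ?x (Suc i))"
      by (simp add: f(2))
    moreover have "of_nat (\<Sum>u\<in>{c j..<c (Suc j)}. card (dominated_lists n (merge_step c j u))) =
        F j (merge_step ?x j (?x (Suc j))) - F j (merge_step ?x j (?x j))" for j
    proof -
      have upd: "merge_step ?x j u = (merge_step ?x j 0)(j := u)" for u
        by (auto simp: merge_step_def)
      have "of_nat (\<Sum>u\<in>{c j..<c (Suc j)}. card (dominated_lists n (merge_step c j u))) =
            (\<Sum>u\<in>{c j..<c (Suc j)}. f ((merge_step ?x j 0)(j := of_nat u)))"
        unfolding of_nat_sum
      proof (rule sum.cong[OF refl])
        fix u assume "u \<in> {c j..<c (Suc j)}"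
        then have "mono (merge_step c j u)" using c by (intro mono_merge_step) auto
        moreover have "(\<lambda>i. of_nat (merge_step c j u i)) = (merge_step ?x j 0)(j := of_nat u)"
          by (auto simp: merge_step_def)
        ultimately show "of_nat (card (dominated_lists n (merge_step c j u))) =
             f ((merge_step ?x j 0)(j := of_nat u))" by (simp add: f(2))
      qed
      also have "\<dots> = F j (merge_step ?x j (?x (Suc j))) - F j (merge_step ?x j (?x j))"
        unfolding upd[of "?x (Suc j)"] upd[of "?x j"] using c by (intro F(2)) (simp add: monoD)
      finally show ?thesis .
    qed
    ultimately show ?thesis
      unfolding card_dominated_lists_Suc[OF c] g_def by simp
  qed
  ultimately show ?case by blast
qed

section \<open>Integer points of the parking-function polytope\<close>

abbreviation partial_sum :: "('n::{finite,linorder} \<Rightarrow> nat) \<Rightarrow> 'n \<Rightarrow> nat" where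
  "partial_sum b i \<equiv> (\<Sum>j\<in>{..i}. b j)"

abbreviation entries :: "('n::finite \<Rightarrow> nat) \<Rightarrow> nat multiset" where
  "entries \<beta> \<equiv> image_mset \<beta> (mset_set UNIV)"

abbreviation point :: "('n::finite \<Rightarrow> nat) \<Rightarrow> real ^ 'n" where
  "point \<beta> \<equiv> (\<chi> i. real (\<beta> i))"

text \<open>
  Parking functions are given by a sorted rearrangement; any rearrangement below the partial sums is as
  good, because exchanging two entries in the wrong order keeps it below the increasing partial sums.
  Among all such rearrangements, one that maximizes \<open>\<Sum>\<^sub>i i \<cdot> \<beta>(\<sigma>(i))\<close> admits no such exchange (rearrangement
  inequality) and is thus sorted.
\<close>

lemma parking_functionI:
  fixes \<sigma> :: "'n::{finite,linorder} \<Rightarrow> 'n"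
  assumes pos: "\<And>i. 0 < \<beta> i" and "bij \<sigma>" "\<And>i. \<beta> (\<sigma> i) \<le> partial_sum b i"
  shows "parking_function b \<beta>"
proof -
  define X where "X = {\<sigma>. bij \<sigma> \<and> (\<forall>i. \<beta> (\<sigma> i) \<le> partial_sum b i)}"
  define \<Phi> where "\<Phi> \<rho> = (\<Sum>i\<in>UNIV. card {..i} * \<beta> (\<rho> i))" for \<rho> :: "'n \<Rightarrow> 'n"
  have "X \<noteq> {}" using assms by (auto simp: X_def)
  then have "Max (\<Phi> ` X) \<in> \<Phi> ` X" by (intro Max_in) auto
  then obtain \<tau> where \<tau>: "\<tau> \<in> X" "\<Phi> \<tau> = Max (\<Phi> ` X)" by auto
  have max: "\<Phi> \<rho> \<le> \<Phi> \<tau>" if "\<rho> \<in> X" for \<rho>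
    unfolding \<tau>(2) using that by (intro Max_ge) auto
  have "mono (\<beta> \<circ> \<tau>)"
  proof (rule ccontr)
    assume "\<not> mono (\<beta> \<circ> \<tau>)"
    then obtain i j where ij: "i < j" "\<beta> (\<tau> j) < \<beta> (\<tau> i)"
      unfolding mono_def by (metis comp_apply le_less linorder_not_le)
    define \<rho> where "\<rho> = \<tau> \<circ> Transposition.transpose i j"
    have \<rho>: "\<rho> i = \<tau> j" "\<rho> j = \<tau> i" "\<And>k. k \<noteq> i \<Longrightarrow> k \<noteq> j \<Longrightarrow> \<rho> k = \<tau> k"
      by (auto simp: \<rho>_def)
    have "\<beta> (\<rho> k) \<le> partial_sum b k" for k
    proof -
      have le: "\<beta> (\<tau> k) \<le> partial_sum b k" for k using \<tau>(1) by (auto simp: X_def)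
      have "partial_sum b i \<le> partial_sum b j" using ij by (intro sum_mono2) auto
      then show ?thesis using le[of i] le[of j] le[of k] ij \<rho> by (cases "k = i"; cases "k = j") auto
    qed
    moreover have "bij \<rho>" using \<tau>(1) by (auto simp: X_def \<rho>_def intro: bij_comp)
    ultimately have "\<rho> \<in> X" by (auto simp: X_def)
    have split: "\<Phi> f = card {..i} * \<beta> (f i) + (card {..j} * \<beta> (f j) +
                   (\<Sum>k\<in>UNIV - {i} - {j}. card {..k} * \<beta> (f k)))" for f
      unfolding \<Phi>_def using ij by (subst sum.remove[of _ i], simp, simp, subst sum.remove[of _ j]) auto
    have rest: "(\<Sum>k\<in>UNIV - {i} - {j}. card {..k} * \<beta> (\<rho> k)) =
                (\<Sum>k\<in>UNIV - {i} - {j}. card {..k} * \<beta> (\<tau> k))"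
      by (intro sum.cong) (auto simp: \<rho>)
    have "card {..i} < card {..j}" using ij by (intro psubset_card_mono) auto
    then obtain p q where "card {..j} = card {..i} + Suc p" "\<beta> (\<tau> i) = \<beta> (\<tau> j) + Suc q"
      using ij(2) by (auto dest!: less_imp_Suc_add)
    then have "\<Phi> \<tau> < \<Phi> \<rho>" unfolding split rest \<rho>(1,2) by (simp add: algebra_simps)
    then show False using max[OF \<open>\<rho> \<in> X\<close>] by simp
  qed
  then show ?thesis
    unfolding parking_function_def using pos \<tau>(1) by (auto simp: X_def intro!: exI[of _ \<tau>])
qed

lemma parking_function_lower:
  assumes "parking_function b \<beta>"
  shows "parking_function b (\<beta>(i := 1))"
proof -
  obtain \<sigma> where "bij \<sigma>" "\<And>k. \<beta> (\<sigma> k) \<le> partial_sum b k" "\<And>k. 0 < \<beta> k"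
    using assms by (auto simp: parking_function_def)
  then show ?thesis
    by (intro parking_functionI[of _ \<sigma>]) (auto intro: order_trans[of "1"] Suc_leI less_le_trans)
qed

lemma parking_function_rearrangement:
  assumes "\<And>i. 0 < b i" "entries \<beta> = entries (partial_sum b)"
  shows "parking_function b \<beta>"
proof -
  obtain p where p: "p permutes UNIV" "\<forall>i\<in>UNIV. partial_sum b i = \<beta> (p i)"
    using image_mset_eq_implies_permutes[OF finite assms(2)[symmetric]] by blast
  have pos: "0 < partial_sum b i" for i
    using assms(1) by (intro sum_pos) auto
  show ?thesis
  proof (rule parking_functionI)
    show "bij p" using p(1) by (rule permutes_bij)
    show "0 < \<beta> i" for i
      using p(2) pos \<open>bij p\<close> by (metis UNIV_I bij_pointE)
  qed (use p in auto)
qed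

lemma excess_entries: "excess (entries \<beta>) s = (\<Sum>i\<in>UNIV. \<beta> i - s)"
  by (simp add: excess_def image_mset.compositionality comp_def sum_unfold_sum_mset)

lemma parking_function_excess_le:
  assumes "parking_function b \<beta>"
  shows "excess (entries \<beta>) s \<le> excess (entries (partial_sum b)) s"
proof -
  obtain \<sigma> where \<sigma>: "bij \<sigma>" "\<And>k. \<beta> (\<sigma> k) \<le> partial_sum b k"
    using assms by (auto simp: parking_function_def)
  have "(\<Sum>i\<in>UNIV. \<beta> i - s) = (\<Sum>i\<in>UNIV. \<beta> (\<sigma> i) - s)"
    using sum.reindex_bij_betw[OF \<sigma>(1), of "\<lambda>i. \<beta> i - s"] by simp
  also have "\<dots> \<le> (\<Sum>i\<in>UNIV. partial_sum b i - s)"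
    using \<sigma>(2) by (intro sum_mono diff_le_mono) auto
  finally show ?thesis by (simp add: excess_entries)
qed

lemma convex_excess_sublevel:
  "convex {x :: real ^ 'n. (\<forall>i. l \<le> x $ i) \<and> (\<forall>s::nat. (\<Sum>i\<in>UNIV. max 0 (x $ i - real s)) \<le> K s)}"
proof (rule convexI, safe)
  fix x y :: "real ^ 'n" and u v :: real and i
  assume "\<forall>i. l \<le> x $ i" "\<forall>i. l \<le> y $ i" and uv: "0 \<le> u" "0 \<le> v" "u + v = 1"
  then have "u * l + v * l \<le> u * x $ i + v * y $ i" by (intro add_mono mult_left_mono) auto
  then show "l \<le> (u *\<^sub>R x + v *\<^sub>R y) $ i" using uv by (simp flip: distrib_right)
next
  fix x y :: "real ^ 'n" and u v :: real and s :: nat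
  assume K: "\<forall>s. (\<Sum>i\<in>UNIV. max 0 (x $ i - real s)) \<le> K s"
    "\<forall>s. (\<Sum>i\<in>UNIV. max 0 (y $ i - real s)) \<le> K s" and uv: "0 \<le> u" "0 \<le> v" "u + v = 1"
  have "max 0 ((u *\<^sub>R x + v *\<^sub>R y) $ i - s) \<le> u * max 0 (x $ i - s) + v * max 0 (y $ i - s)" for i
  proof -
    have "u * (x $ i - s) + v * (y $ i - s) \<le> u * max 0 (x $ i - s) + v * max 0 (y $ i - s)"
      using uv by (intro add_mono mult_left_mono) auto
    moreover have "u * (x $ i - s) + v * (y $ i - s) = u * x $ i + v * y $ i - (u + v) * s"
      by (simp add: algebra_simps)
    ultimately show ?thesis using uv by simp
  qed
  then have "(\<Sum>i\<in>UNIV. max 0 ((u *\<^sub>R x + v *\<^sub>R y) $ i - s)) \<le>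
        u * (\<Sum>i\<in>UNIV. max 0 (x $ i - s)) + v * (\<Sum>i\<in>UNIV. max 0 (y $ i - s))"
    by (simp add: sum_distrib_left sum.distrib[symmetric] sum_mono)
  also have "\<dots> \<le> u * K s + v * K s"
    using uv K by (intro add_mono mult_left_mono) auto
  also have "\<dots> = K s" using uv by (simp flip: distrib_right)
  finally show "(\<Sum>i\<in>UNIV. max 0 ((u *\<^sub>R x + v *\<^sub>R y) $ i - s)) \<le> K s" .
qed

lemma real_excess_point:
  "(\<Sum>i\<in>UNIV. max 0 (point \<beta> $ i - real s)) = real (excess (entries \<beta>) s)"
  unfolding excess_entries of_nat_sum by (intro sum.cong) (auto simp: max_def)

text \<open>
  The submajorization inequalities cut out a convex set that contains all parking functions.
\<close>

lemma integer_point_of_parking_polytope: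
  fixes b :: "'n::{finite,linorder} \<Rightarrow> nat"
  assumes "x \<in> parking_polytope b \<inter> integer_points"
  obtains \<beta> where "x = point \<beta>" "\<forall>i. 0 < \<beta> i" "submajorized (entries \<beta>) (entries (partial_sum b))"
proof -
  let ?Q = "{x :: real ^ ('n::{finite,linorder}). (\<forall>i. 1 \<le> x $ i) \<and>
    (\<forall>s::nat. (\<Sum>i\<in>UNIV. max 0 (x $ i - real s)) \<le> real (excess (entries (partial_sum b)) s))}"
  have "parking_polytope b \<subseteq> ?Q"
    unfolding parking_polytope_def
  proof (rule hull_minimal)
    show "{point \<beta> |\<beta>. parking_function b \<beta>} \<subseteq> ?Q"
    proof safe
      fix \<beta> :: "'n \<Rightarrow> nat" and i assume "parking_function b \<beta>"
      then have "0 < \<beta> i" by (auto simp: parking_function_def)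
      then show "1 \<le> point \<beta> $ i" by simp
    next
      fix \<beta> :: "'n \<Rightarrow> nat" and s assume "parking_function b \<beta>"
      then show "(\<Sum>i\<in>UNIV. max 0 (point \<beta> $ i - real s)) \<le> real (excess (entries (partial_sum b)) s)"
        unfolding real_excess_point by (simp add: parking_function_excess_le)
    qed
  qed (rule convex_excess_sublevel)
  then have Q: "x \<in> ?Q" using assms by auto
  define \<beta> where "\<beta> i = nat \<lfloor>x $ i\<rfloor>" for i
  have x: "x = point \<beta>"
  proof (rule vec_eq_iff[THEN iffD2], rule allI)
    fix i
    have "x $ i \<in> \<int>" "1 \<le> x $ i" using assms Q by (auto simp: integer_points_def)
    then show "x $ i = point \<beta> $ i" by (auto simp: \<beta>_def elim!: Ints_cases)
  qed
  show ?thesis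
  proof (rule that[OF x])
    have "1 \<le> real (\<beta> i)" for i using Q by (auto simp: x)
    then show "\<forall>i. 0 < \<beta> i" by (metis of_nat_0_less_iff zero_less_one less_le_trans)
    have "real (excess (entries \<beta>) s) \<le> real (excess (entries (partial_sum b)) s)" for s
      unfolding real_excess_point[of \<beta>, symmetric] using Q unfolding x by blast
    then show "submajorized (entries \<beta>) (entries (partial_sum b))"
      by (simp add: submajorized_def)
  qed
qed

lemma entries_add_msetE:
  assumes "entries \<beta> = add_mset u N"
  obtains i where "\<beta> i = u" "image_mset \<beta> (mset_set (UNIV - {i})) = N"
proof -
  have "u \<in># entries \<beta>" using assms by simp
  then obtain i where i: "\<beta> i = u" by auto
  have "entries \<beta> = add_mset (\<beta> i) (image_mset \<beta> (mset_set (UNIV - {i})))"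
    by (subst mset_set.remove[of _ i]) auto
  then show ?thesis using that[OF i] assms i by simp
qed

lemma entries_fun_upd:
  "entries (\<beta>(i := a)) = add_mset a (image_mset \<beta> (mset_set (UNIV - {i})))"
  by (subst mset_set.remove[of _ i]) (auto intro!: image_mset_cong)

text \<open>
  If \<open>\<beta>\<close> has the entries \<open>a + b - t\<close> and \<open>t\<close> at the positions \<open>i\<close> and \<open>j\<close>, it lies on the segment between the two
  vectors with entries \<open>b, a\<close> and \<open>a, b\<close> there.
\<close>

lemma point_mem_transfer:
  fixes C :: "(real ^ 'n::finite) set"
  assumes "convex C" and bt: "b \<le> t" "t \<le> a"
    and P: "\<And>\<beta>. entries \<beta> = add_mset a (add_mset b M) \<Longrightarrow> point \<beta> \<in> C"
    and \<beta>: "entries \<beta> = add_mset (a + b - t) (add_mset t M)"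
  shows "point \<beta> \<in> C"
proof (cases "a = b")
  case True
  then show ?thesis using assms by simp
next
  case False
  obtain i where i: "\<beta> i = a + b - t" "image_mset \<beta> (mset_set (UNIV - {i})) = add_mset t M"
    using entries_add_msetE[OF \<beta>] .
  have "entries (\<beta>(i := a)) = add_mset t (add_mset a M)"
    unfolding entries_fun_upd i by (rule add_mset_commute)
  then have "t \<in># image_mset \<beta> (mset_set (UNIV - {i}))" by (simp add: i)
  then obtain j where j: "j \<noteq> i" "\<beta> j = t" by auto
  have ent: "entries (\<beta>(i := c, j := d)) = add_mset c (add_mset d M)" for c d
  proof -
    have "mset_set (UNIV - {i}) = add_mset j (mset_set (UNIV - {i} - {j}))"
      using j by (subst mset_set.remove[of _ j]) auto
    with i j have M: "image_mset \<beta> (mset_set (UNIV - {i} - {j})) = M" by simp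
    have "mset_set (UNIV :: 'n set) = add_mset i (add_mset j (mset_set (UNIV - {i} - {j})))"
      using j by (simp add: mset_set.remove[of _ i] mset_set.remove[of _ j])
    moreover have "image_mset (\<beta>(i := c, j := d)) (mset_set (UNIV - {i} - {j})) = M"
      unfolding M[symmetric] by (intro image_mset_cong) auto
    ultimately show ?thesis using j by simp
  qed
  define l where "l = (real t - real b) / (real a - real b)"
  have ab: "real b < real a" using False bt by simp
  have l: "0 \<le> l" "0 \<le> 1 - l" using ab bt by (auto simp: l_def field_simps)
  have eq: "l * (real a - real b) = real t - real b" using ab by (simp add: l_def)
  have "point (\<beta>(i := b, j := a)) \<in> C" "point (\<beta>(i := a, j := b)) \<in> C"
    by (rule P, simp only: ent add_mset_commute)+
  then have "l *\<^sub>R point (\<beta>(i := b, j := a)) + (1 - l) *\<^sub>R point (\<beta>(i := a, j := b)) \<in> C"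
    using l by (intro convexD[OF assms(1)]) auto
  also have "l *\<^sub>R point (\<beta>(i := b, j := a)) + (1 - l) *\<^sub>R point (\<beta>(i := a, j := b)) = point \<beta>"
  proof (rule vec_eq_iff[THEN iffD2], rule allI)
    fix k
    consider "k = i" | "k = j" "k \<noteq> i" | "k \<noteq> i" "k \<noteq> j" by blast
    then show "(l *\<^sub>R point (\<beta>(i := b, j := a)) + (1 - l) *\<^sub>R point (\<beta>(i := a, j := b))) $ k = point \<beta> $ k"
    proof cases
      case 1
      then show ?thesis using i j bt eq by (simp add: algebra_simps)
    next
      case 2
      then show ?thesis using i j bt eq by (simp add: algebra_simps)
    next
      case 3
      then show ?thesis by (simp add: algebra_simps)
    qed
  qed
  finally show ?thesis .
qed

lemma parking_function_point: "parking_function b \<beta> \<Longrightarrow> point \<beta> \<in> parking_polytope b"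
  unfolding parking_polytope_def by (rule hull_inc) blast

lemma convex_parking_polytope: "convex (parking_polytope b)"
  by (simp add: parking_polytope_def)

text \<open>
  Setting one coordinate to \<open>1\<close> is an affine map that preserves parking functions, hence the polytope;
  a smaller decrease is a convex combination of this and the original point.
\<close>

lemma parking_polytope_lower_coordinate:
  fixes x :: "real ^ ('n::{finite,linorder})"
  assumes x: "x \<in> parking_polytope b" and t: "1 \<le> t" "t \<le> x $ i"
  shows "(\<chi> k. if k = i then t else x $ k) \<in> parking_polytope b"
proof -
  define low :: "real ^ ('n::{finite,linorder}) \<Rightarrow> real ^ ('n::{finite,linorder})" where "low y = (\<chi> k. if k = i then 1 else y $ k)" for y
  have "parking_polytope b \<subseteq> {y. low y \<in> parking_polytope b}"
  proof (subst (1) parking_polytope_def, rule hull_minimal)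
    show "{point \<beta> |\<beta>. parking_function b \<beta>} \<subseteq> {y. low y \<in> parking_polytope b}"
    proof safe
      fix \<beta> :: "'n \<Rightarrow> nat" assume "parking_function b \<beta>"
      then have "point (\<beta>(i := 1)) \<in> parking_polytope b"
        by (intro parking_function_point parking_function_lower)
      moreover have "low (point \<beta>) = point (\<beta>(i := 1))"
        by (auto simp: low_def vec_eq_iff)
      ultimately show "low (point \<beta>) \<in> parking_polytope b" by simp
    qed
    show "convex {y. low y \<in> parking_polytope b}"
    proof (rule convexI, safe)
      fix y z :: "real ^ ('n::{finite,linorder})" and u v :: real
      assume *: "low y \<in> parking_polytope b" "low z \<in> parking_polytope b"
        "0 \<le> u" "0 \<le> v" "u + v = 1"
      have "low (u *\<^sub>R y + v *\<^sub>R z) = u *\<^sub>R low y + v *\<^sub>R low z"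
        using * by (auto simp: low_def vec_eq_iff)
      then show "low (u *\<^sub>R y + v *\<^sub>R z) \<in> parking_polytope b"
        using convexD[OF convex_parking_polytope *] by simp
    qed
  qed
  then have low: "low x \<in> parking_polytope b" using x by auto
  show ?thesis
  proof (cases "x $ i = 1")
    case True
    then have "(\<chi> k. if k = i then t else x $ k) = x" using t by (auto simp: vec_eq_iff)
    then show ?thesis using x by simp
  next
    case False
    define l where "l = (t - 1) / (x $ i - 1)"
    have l: "0 \<le> l" "0 \<le> 1 - l" "l * (x $ i - 1) = t - 1"
      using False t by (auto simp: l_def field_simps)
    have "l *\<^sub>R x + (1 - l) *\<^sub>R low x \<in> parking_polytope b"
      using l by (intro convexD[OF convex_parking_polytope x low]) auto
    also have "l *\<^sub>R x + (1 - l) *\<^sub>R low x = (\<chi> k. if k = i then t else x $ k)"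
      using l(3) by (auto simp: vec_eq_iff low_def algebra_simps)
    finally show ?thesis .
  qed
qed

lemma point_mem_parking_polytope:
  fixes b :: "'n::{finite,linorder} \<Rightarrow> nat"
  assumes b: "\<And>i. 0 < b i" and \<beta>: "\<forall>i. 0 < \<beta> i"
    and sub: "submajorized (entries \<beta>) (entries (partial_sum b))"
  shows "point \<beta> \<in> parking_polytope b"
proof -
  define P where "P M \<longleftrightarrow> (\<forall>\<beta>. entries \<beta> = M \<longrightarrow> point \<beta> \<in> parking_polytope b)" for M
  have "P (entries \<beta> + {#})"
  proof (rule submajorized_transfer[where P = P and D = "entries (partial_sum b)"])
    fix a b' t M assume "b' \<le> t" "t \<le> a" "P (add_mset a (add_mset b' M))"
    then show "P (add_mset (a + b' - t) (add_mset t M))"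
      using point_mem_transfer[OF convex_parking_polytope, of b' t a M] unfolding P_def by blast
  next
    fix c t M assume t: "0 < t" "t \<le> c" and P: "P (add_mset c M)"
    show "P (add_mset t M)"
      unfolding P_def
    proof (intro allI impI)
      fix \<beta> :: "'n \<Rightarrow> nat" assume "entries \<beta> = add_mset t M"
      then obtain i where i: "\<beta> i = t" "image_mset \<beta> (mset_set (UNIV - {i})) = M"
        by (rule entries_add_msetE)
      then have "entries (\<beta>(i := c)) = add_mset c M"
        by (simp only: entries_fun_upd)
      then have "point (\<beta>(i := c)) \<in> parking_polytope b"
        using P unfolding P_def by blast
      then have "(\<chi> k. if k = i then real t else point (\<beta>(i := c)) $ k) \<in> parking_polytope b"
        using t by (intro parking_polytope_lower_coordinate) auto
      also have "(\<chi> k. if k = i then real t else point (\<beta>(i := c)) $ k) = point \<beta>"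
        using i by (auto simp: vec_eq_iff)
      finally show "point \<beta> \<in> parking_polytope b" .
    qed
  next
    show "P (entries (partial_sum b) + {#})"
      unfolding P_def using b
      by (auto intro!: parking_function_point parking_function_rearrangement)
  qed (use sub \<beta> in auto)
  then show ?thesis by (simp add: P_def)
qed

section \<open>From polynomial functions to formal polynomials\<close>

lemma mpoly_eval_superset:
  fixes x :: "'v::finite \<Rightarrow> rat"
  assumes "finite M" "Poly_Mapping.keys p \<subseteq> M"
  shows "mpoly_eval p x =
           (\<Sum>m\<in>M. Poly_Mapping.lookup p m * (\<Prod>v\<in>UNIV. x v ^ Poly_Mapping.lookup m v))"
proof -
  have "(\<Prod>v\<in>Poly_Mapping.keys m. x v ^ Poly_Mapping.lookup m v) =
        (\<Prod>v\<in>UNIV. x v ^ Poly_Mapping.lookup m v)" for m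
    by (intro prod.mono_neutral_left) (auto simp: in_keys_iff)
  then show ?thesis unfolding mpoly_eval_def
    using assms by (simp, intro sum.mono_neutral_left) (auto simp: in_keys_iff)
qed

lemma mpoly_eval_add:
  fixes x :: "'v::finite \<Rightarrow> rat"
  shows "mpoly_eval (p + q) x = mpoly_eval p x + mpoly_eval q x"
proof -
  define M where "M = Poly_Mapping.keys p \<union> Poly_Mapping.keys q"
  have M: "finite M" "Poly_Mapping.keys p \<subseteq> M" "Poly_Mapping.keys q \<subseteq> M"
    "Poly_Mapping.keys (p + q) \<subseteq> M"
    using Poly_Mapping.keys_add[of p q] by (auto simp: M_def)
  show ?thesis
    by (simp add: mpoly_eval_superset[OF M(1)] M lookup_add distrib_right sum.distrib)
qed

lemma mpoly_degree_le_iff: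
  "mpoly_degree p \<le> k \<longleftrightarrow>
   (\<forall>m\<in>Poly_Mapping.keys p. (\<Sum>v\<in>Poly_Mapping.keys m. Poly_Mapping.lookup m v) \<le> k)"
  unfolding mpoly_degree_def by (subst Max_le_iff) auto

lemma mpoly_degree_add:
  "mpoly_degree p \<le> k \<Longrightarrow> mpoly_degree q \<le> k \<Longrightarrow> mpoly_degree (p + q) \<le> k"
  using Poly_Mapping.keys_add[of p q] by (auto simp: mpoly_degree_le_iff)

lemma mpoly_degree_single:
  fixes m :: "'v::finite \<Rightarrow>\<^sub>0 nat"
  assumes "(\<Sum>v\<in>UNIV. Poly_Mapping.lookup m v) \<le> k"
  shows "mpoly_degree (Poly_Mapping.single m c) \<le> k"
proof -
  have "(\<Sum>v\<in>Poly_Mapping.keys m. Poly_Mapping.lookup m v) \<le> (\<Sum>v\<in>UNIV. Poly_Mapping.lookup m v)"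
    by (intro sum_mono2) auto
  then show ?thesis using assms by (auto simp: mpoly_degree_le_iff)
qed

lemma mpoly_eval_single:
  fixes x :: "'v::finite \<Rightarrow> rat"
  shows "mpoly_eval (Poly_Mapping.single m c) x = c * (\<Prod>v\<in>UNIV. x v ^ Poly_Mapping.lookup m v)"
  by (subst mpoly_eval_superset[of "{m}"]) auto

text \<open>
  The factor accumulated along the induction is the monomial with exponents \<open>m\<close>; it turns
  the multiplication by a variable into a change of exponents.
\<close>

lemma poly_fun_imp_mpolynomial:
  fixes f :: "('v::finite \<Rightarrow> rat) \<Rightarrow> rat"
  assumes "poly_fun k f"
  shows "\<exists>L. mpoly_degree L \<le> k \<and> (\<forall>x. mpoly_eval L x = f x)"
proof -
  have "\<exists>L. mpoly_degree L \<le> k + (\<Sum>v\<in>UNIV. Poly_Mapping.lookup m v) \<and>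
            (\<forall>x. mpoly_eval L x = (\<Prod>v\<in>UNIV. x v ^ Poly_Mapping.lookup m v) * f x)" for m
    using assms
  proof (induction arbitrary: m)
    case (poly_fun_const k c)
    show ?case
      by (intro exI[of _ "Poly_Mapping.single m c"])
         (auto simp: mpoly_eval_single intro!: mpoly_degree_single)
  next
    case (poly_fun_add k f g)
    then obtain L1 L2 where
      "mpoly_degree L1 \<le> k + (\<Sum>v\<in>UNIV. Poly_Mapping.lookup m v)"
      "\<forall>x. mpoly_eval L1 x = (\<Prod>v\<in>UNIV. x v ^ Poly_Mapping.lookup m v) * f x"
      "mpoly_degree L2 \<le> k + (\<Sum>v\<in>UNIV. Poly_Mapping.lookup m v)"
      "\<forall>x. mpoly_eval L2 x = (\<Prod>v\<in>UNIV. x v ^ Poly_Mapping.lookup m v) * g x"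
      by blast
    then show ?case
      by (intro exI[of _ "L1 + L2"]) (simp add: mpoly_degree_add mpoly_eval_add distrib_left)
  next
    case (poly_fun_var_mult k f w)
    define m' where "m' = m + Poly_Mapping.single w 1"
    have m': "Poly_Mapping.lookup m' v = Poly_Mapping.lookup m v + (if v = w then 1 else 0)" for v
      by (simp add: m'_def lookup_add lookup_single when_def)
    have "(\<Sum>v\<in>UNIV. Poly_Mapping.lookup m' v) = Suc (\<Sum>v\<in>UNIV. Poly_Mapping.lookup m v)"
      by (simp add: m' sum.distrib)
    moreover have "(\<Prod>v\<in>UNIV. x v ^ Poly_Mapping.lookup m' v) =
                   (\<Prod>v\<in>UNIV. x v ^ Poly_Mapping.lookup m v) * x w" for x :: "'v \<Rightarrow> rat"
      by (simp add: m' power_add prod.distrib if_distrib[of "power _"] cong: if_cong)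
    ultimately show ?case using poly_fun_var_mult.IH[of m'] by (simp add: mult.assoc)
  qed
  from this[of 0] show ?thesis by simp
qed

text \<open>
  Kronecker substitution: with suitable weights \<open>w\<close>, the substitution \<open>x\<^sub>v = t^(w v)\<close> sends
  monomials in the variables \<open>V\<close> with different exponents, taken from \<open>M\<close>, to different powers of \<open>t\<close>.
\<close>

lemma separating_weights:
  fixes M :: "('v::finite \<Rightarrow> nat) set"
  assumes "finite V" "finite M"
  shows "\<exists>w::'v \<Rightarrow> nat. \<forall>m\<in>M. \<forall>m'\<in>M.
           (\<Sum>v\<in>V. w v * m v) = (\<Sum>v\<in>V. w v * m' v) \<longrightarrow> (\<forall>v\<in>V. m v = m' v)"
  using assms(1)
proof induction
  case (insert u V)
  then obtain w where w: "\<forall>m\<in>M. \<forall>m'\<in>M.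
      (\<Sum>v\<in>V. w v * m v) = (\<Sum>v\<in>V. w v * m' v) \<longrightarrow> (\<forall>v\<in>V. m v = m' v)" by blast
  \<comment> \<open>The new variable receives a weight B exceeding all old weighted sums, so that
    quotient and remainder modulo B can be read off from the new sum.\<close>
  define S where "S m = (\<Sum>v\<in>V. w v * m v)" for m
  define B where "B = Suc (Max (insert 0 (S ` M)))"
  have B: "S m < B" if "m \<in> M" for m
    using that assms(2) by (auto simp: B_def less_Suc_eq_le)
  define w' where "w' = w(u := B)"
  have w': "(\<Sum>v\<in>insert u V. w' v * m v) = B * m u + S m" for m
  proof -
    have "(\<Sum>v\<in>V. w' v * m v) = S m"
      unfolding S_def w'_def using insert by (intro sum.cong) auto
    then show ?thesis using insert by (simp add: w'_def)
  qed
  have "\<forall>v\<in>insert u V. m v = m' v"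
    if "m \<in> M" "m' \<in> M" "B * m u + S m = B * m' u + S m'" for m m'
  proof -
    have "S m = S m'"
    proof -
      have "S m = (B * m u + S m) mod B" using B[OF that(1)] by simp
      also have "\<dots> = S m'" unfolding that(3) using B[OF that(2)] by simp
      finally show ?thesis .
    qed
    moreover have "m u = m' u"
      using that(3) \<open>S m = S m'\<close> B[OF that(1)] by auto
    ultimately show ?thesis using w that by (auto simp: S_def)
  qed
  then show ?case by (intro exI[of _ w']) (simp add: w')
qed simp

text \<open>
  After a Kronecker substitution the difference of the two polynomials is a univariate polynomial with the
  same coefficients that vanishes at all positive integers.
\<close>

lemma mpoly_eval_positive_eq_imp_eq:
  fixes p q :: "('v::finite, rat) mpolynomial"
  assumes eq: "\<And>b :: 'v \<Rightarrow> nat. \<forall>v. 0 < b v \<Longrightarrow>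
                 mpoly_eval p (\<lambda>v. of_nat (b v)) = mpoly_eval q (\<lambda>v. of_nat (b v))"
  shows "p = q"
proof -
  define M where "M = Poly_Mapping.keys p \<union> Poly_Mapping.keys q"
  define c where "c m = Poly_Mapping.lookup p m - Poly_Mapping.lookup q m" for m
  have M: "finite M" "Poly_Mapping.keys p \<subseteq> M" "Poly_Mapping.keys q \<subseteq> M"
    by (auto simp: M_def)
  obtain w :: "'v \<Rightarrow> nat" where w: "\<forall>m\<in>Poly_Mapping.lookup ` M. \<forall>m'\<in>Poly_Mapping.lookup ` M.
      (\<Sum>v\<in>UNIV. w v * m v) = (\<Sum>v\<in>UNIV. w v * m' v) \<longrightarrow> (\<forall>v\<in>UNIV. m v = m' v)"
    using separating_weights[of UNIV "Poly_Mapping.lookup ` M"] M by auto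
  define e where "e m = (\<Sum>v\<in>UNIV. w v * Poly_Mapping.lookup m v)" for m
  have inj: "m = m'" if "m \<in> M" "m' \<in> M" "e m = e m'" for m m'
    using bspec[OF bspec[OF w imageI[OF that(1)]] imageI[OF that(2)]] that(3)
    by (intro poly_mapping_eqI) (simp add: e_def)
  define P where "P = (\<Sum>m\<in>M. Polynomial.monom (c m) (e m))"
  have root: "poly P (of_nat (Suc t)) = 0" for t
  proof -
    define b where "b v = Suc t ^ w v" for v
    have mono: "(\<Prod>v\<in>UNIV. of_nat (b v) ^ Poly_Mapping.lookup m v) = (of_nat (Suc t) :: rat) ^ e m" for m
      by (simp add: b_def e_def power_sum power_mult)
    have "(\<Sum>m\<in>M. c m * of_nat (Suc t) ^ e m) =
          mpoly_eval p (\<lambda>v. of_nat (b v)) - mpoly_eval q (\<lambda>v. of_nat (b v))"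
      unfolding mpoly_eval_superset[OF M(1,2)] mpoly_eval_superset[OF M(1,3)] mono c_def
      by (simp add: left_diff_distrib sum_subtractf)
    also have "\<dots> = 0" using eq[of b] by (simp add: b_def)
    finally show ?thesis by (simp add: P_def poly_sum poly_monom)
  qed
  have "P = 0"
  proof (rule ccontr)
    assume "P \<noteq> 0"
    then have "finite {x. poly P x = 0}" by (rule poly_roots_finite)
    moreover have "range (\<lambda>t. of_nat (Suc t)) \<subseteq> {x. poly P x = 0}" using root by auto
    moreover have "inj (\<lambda>t. of_nat (Suc t) :: rat)" by (auto intro!: injI)
    ultimately show False
      by (meson finite_subset finite_imageD infinite_UNIV_nat)
  qed
  have "c m = 0" if "m \<in> M" for m
  proof -
    have "0 = Polynomial.coeff P (e m)" by (simp add: \<open>P = 0\<close>)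
    also have "\<dots> = (\<Sum>m'\<in>M. if m' = m then c m' else 0)"
      unfolding P_def coeff_sum using inj that by (intro sum.cong) auto
    also have "\<dots> = c m" using that M by simp
    finally show ?thesis by simp
  qed
  moreover have "c m = 0" if "m \<notin> M" for m
    using that by (auto simp: c_def M_def in_keys_iff)
  ultimately have "c m = 0" for m by blast
  then show ?thesis by (intro poly_mapping_eqI) (simp add: c_def)
qed

section \<open>The lattice-point polynomial\<close>

lemma partial_sum_sorted_nth:
  fixes b :: "'n::{finite,linorder} \<Rightarrow> nat"
  defines "e \<equiv> sorted_list_of_set (UNIV :: 'n set)"
  assumes "i < CARD('n)"
  shows "partial_sum b (e ! i) = (\<Sum>v\<in>set (take (Suc i) e). b v)"
proof -
  have e: "sorted e" "distinct e" "set e = UNIV" "length e = CARD('n)"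
    by (simp_all add: e_def)
  have "{..e ! i} = set (take (Suc i) e)"
  proof (intro equalityI subsetI)
    fix v assume "v \<in> {..e ! i}"
    moreover obtain k where k: "k < CARD('n)" "e ! k = v"
      using e by (metis UNIV_I in_set_conv_nth)
    ultimately have "k \<le> i"
      using e assms(2) by (metis atMost_iff linorder_le_cases nth_eq_iff_index_eq order_antisym sorted_nth_mono)
    then show "v \<in> set (take (Suc i) e)"
      using k e assms(2) by (auto simp: in_set_conv_nth intro!: exI[of _ k])
  next
    fix v assume "v \<in> set (take (Suc i) e)"
    then obtain k where "k \<le> i" "v = e ! k"
      unfolding in_set_conv_nth by (metis length_take less_Suc_eq_le min_less_iff_conj nth_take)
    then show "v \<in> {..e ! i}" using e assms(2) by (auto intro: sorted_nth_mono)
  qed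
  then show ?thesis by simp
qed

lemma card_integer_points_eq_dominated_lists:
  fixes b :: "'n::{finite,linorder} \<Rightarrow> nat"
  defines "e \<equiv> sorted_list_of_set (UNIV :: 'n set)"
  assumes b: "\<And>i. 0 < b i"
  shows "card (parking_polytope b \<inter> integer_points) =
         card (dominated_lists CARD('n) (\<lambda>i. \<Sum>v\<in>set (take (Suc i) e). b v))"
proof -
  define c where "c i = (\<Sum>v\<in>set (take (Suc i) e). b v)" for i
  have e: "distinct e" "set e = UNIV" "length e = CARD('n)"
    by (simp_all add: e_def)
  have entries: "mset (map \<beta> e) = entries \<beta>" for \<beta> :: "'n \<Rightarrow> nat"
    by (simp add: e(2) flip: mset_set_set[OF e(1)])
  have "map c [0..<CARD('n)] = map (partial_sum b) e"
    using e(3) by (intro nth_equalityI) (auto simp: c_def e_def partial_sum_sorted_nth)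
  then have D: "mset (map c [0..<CARD('n)]) = entries (partial_sum b)"
    by (metis entries)
  define B where "B = {\<beta> :: 'n \<Rightarrow> nat. (\<forall>i. 0 < \<beta> i) \<and> submajorized (entries \<beta>) (entries (partial_sum b))}"
  have "bij_betw point B (parking_polytope b \<inter> integer_points)"
  proof (rule bij_betwI')
    show "point \<beta> = point \<gamma> \<longleftrightarrow> \<beta> = \<gamma>" for \<beta> \<gamma> :: "'n \<Rightarrow> nat"
      by (auto simp: vec_eq_iff)
    show "point \<beta> \<in> parking_polytope b \<inter> integer_points" if "\<beta> \<in> B" for \<beta>
      using that point_mem_parking_polytope[OF b] by (auto simp: B_def integer_points_def)
    show "\<exists>\<beta>\<in>B. x = point \<beta>" if "x \<in> parking_polytope b \<inter> integer_points" for x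
      using integer_point_of_parking_polytope[OF that] by (auto simp: B_def)
  qed
  moreover have "bij_betw (\<lambda>\<beta>. map \<beta> e) B (dominated_lists CARD('n) c)"
  proof (rule bij_betwI')
    show "map \<beta> e = map \<gamma> e \<longleftrightarrow> \<beta> = \<gamma>" for \<beta> \<gamma> :: "'n \<Rightarrow> nat"
      by (auto simp: e(2))
    show "map \<beta> e \<in> dominated_lists CARD('n) c" if "\<beta> \<in> B" for \<beta>
      unfolding dominated_lists_def D entries mem_Collect_eq using that e by (auto simp: B_def)
    show "\<exists>\<beta>\<in>B. ys = map \<beta> e" if "ys \<in> dominated_lists CARD('n) c" for ys
    proof -
      have ys: "length ys = length e" "\<forall>y\<in>set ys. 0 < y" "submajorized (mset ys) (entries (partial_sum b))"
        using that unfolding dominated_lists_def D e(3) by auto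
      define \<beta> where "\<beta> = the \<circ> map_of (zip e ys)"
      have map: "map \<beta> e = ys"
        using ys(1) e(1) by (intro nth_equalityI) (auto simp: \<beta>_def map_of_zip_nth)
      have "0 < \<beta> i" for i
        using ys(2) e(2) unfolding map[symmetric] by simp
      moreover have "entries \<beta> = mset ys"
        using entries[of \<beta>] by (simp only: map)
      ultimately have "\<beta> \<in> B"
        using ys(3) by (simp only: B_def mem_Collect_eq) blast
      then show ?thesis using map by auto
    qed
  qed
  ultimately show ?thesis
    unfolding c_def by (metis bij_betw_same_card)
qed

theorem proposition5p4:
  shows "\<exists>!L :: ('n::{finite,linorder}, rat) mpolynomial.
           mpoly_degree L \<le> CARD('n) \<and>
           (\<forall>b :: 'n \<Rightarrow> nat. (\<forall>i. 0 < b i) \<longrightarrow>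
              of_nat (card (parking_polytope b \<inter> integer_points)) = mpoly_eval L (\<lambda>i. of_nat (b i)))"
proof (rule ex_ex1I)
  define e where "e = sorted_list_of_set (UNIV :: 'n set)"
  define S :: "('n \<Rightarrow> rat) \<Rightarrow> nat \<Rightarrow> rat" where "S x i = (\<Sum>v\<in>set (take (Suc i) e). x v)" for x i
  obtain f :: "(nat \<Rightarrow> rat) \<Rightarrow> rat" where f: "poly_fun CARD('n) f"
    "\<And>c. mono c \<Longrightarrow> of_nat (card (dominated_lists CARD('n) c)) = f (\<lambda>i. of_nat (c i))"
    using card_dominated_lists_polynomial by blast
  have "poly_fun CARD('n) (\<lambda>x. f (S x))"
    using f(1) by (rule poly_fun_compose) (simp add: S_def poly_fun_sum poly_fun_var)
  then obtain L :: "('n, rat) mpolynomial" where L: "mpoly_degree L \<le> CARD('n)" "\<And>x. mpoly_eval L x = f (S x)"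
    using poly_fun_imp_mpolynomial by blast
  have "of_nat (card (parking_polytope b \<inter> integer_points)) = mpoly_eval L (\<lambda>i. of_nat (b i))"
    if "\<forall>i. 0 < b i" for b :: "'n \<Rightarrow> nat"
  proof -
    have "mono (\<lambda>i. \<Sum>v\<in>set (take (Suc i) e). b v)"
      by (intro monoI sum_mono2 set_take_subset_set_take) auto
    then show ?thesis
      using that by (simp add: L(2) f(2) S_def[abs_def] card_integer_points_eq_dominated_lists e_def)
  qed
  with L(1) show "\<exists>L :: ('n, rat) mpolynomial. mpoly_degree L \<le> CARD('n) \<and>
      (\<forall>b :: 'n \<Rightarrow> nat. (\<forall>i. 0 < b i) \<longrightarrow>
         of_nat (card (parking_polytope b \<inter> integer_points)) = mpoly_eval L (\<lambda>i. of_nat (b i)))"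
    by blast
next
  fix L L' :: "('n, rat) mpolynomial"
  assume "mpoly_degree L \<le> CARD('n) \<and> (\<forall>b :: 'n \<Rightarrow> nat. (\<forall>i. 0 < b i) \<longrightarrow>
      of_nat (card (parking_polytope b \<inter> integer_points)) = mpoly_eval L (\<lambda>i. of_nat (b i)))"
    and "mpoly_degree L' \<le> CARD('n) \<and> (\<forall>b :: 'n \<Rightarrow> nat. (\<forall>i. 0 < b i) \<longrightarrow>
      of_nat (card (parking_polytope b \<inter> integer_points)) = mpoly_eval L' (\<lambda>i. of_nat (b i)))"
  then show "L = L'" by (intro mpoly_eval_positive_eq_imp_eq) metis
qed

end
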